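(* Fix $0<\alpha<1$. Let $X_1,\dots,X_n$ be i.i.d. with c.d.f. $F(t)=(1-\varepsilon_n)\Phi(t)+\varepsilon_n\int\Phi(t-\mu)\,dH(\mu)$, where $\varepsilon_n\in[0,1]$ and $H$ is a probability distribution on $\mathbb{R}$, and let $\hat\varepsilon^*_{a_n}$, $W_n^+$ and $W_n^{++}$ be as defined in the context. (i) Let $a_n$ be chosen so that $P(W_n^+\ge a_n)\le\alpha/2$. Then, for every $n$ and every such mixture with $H((0,\sqrt{2\log n}\,])=1$, $$P\{\hat\varepsilon^*_{a_n}\le\varepsilon_n\}\ge 1-\alpha.$$ (ii) Let $a_n$ be chosen so that $P(W_n^{++}\ge a_n)\le\alpha$. Then, as $n\to\infty$, uniformly over all such mixtures with $H((0,\infty))=1$, $$P\{\hat\varepsilon^*_{a_n}\le\varepsilon_n\}\ge(1-\alpha)(1+o(1)).$$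
   Context: $\Phi$ is the standard normal c.d.f., $\log$ is the natural logarithm, and $n\ge2$. Definition of the estimator $\hat\varepsilon^*_{a}$ for a given $a>0$ and a sample $X_1,\dots,X_n$. Let $F_n(t)=\frac1n\#\{i:X_i\le t\}$ be the empirical c.d.f. Define $$F_a^{\pm}(t)=\frac{2F_n(t)+a^2/n\pm\frac{a}{\sqrt n}\sqrt{a^2/n+4F_n(t)-4F_n(t)^2}}{2(1+a^2/n)},$$ the two solutions $x$ of $\sqrt n\,|F_n(t)-x|=a\sqrt{x(1-x)}$. For $0\le\tau<\tau'$ and $\mu>0$ let $$D(\mu;\tau,\tau')=\frac{\Phi(\tau)-\Phi(\tau-\mu)}{\Phi(\tau')-\Phi(\tau'-\mu)},$$ which is strictly decreasing in $\mu>0$. Let $t_j=(j-1)/\sqrt{2\log n}$ for integers $1\le j\le 2\log n+1$. For each integer $1\le j\le 2\log n$, if the equation $$D(\mu;t_j,t_{j+1})=\frac{\Phi(t_j)-F_a^+(t_j)}{\Phi(t_{j+1})-F_a^-(t_{j+1})}$$ has a solution $\mu=\hat\mu^{(j)}_a>0$, set $$\hat\varepsilon^{(j)}_a=\frac{\Phi(t_j)-F_a^+(t_j)}{\Phi(t_j)-\Phi(t_j-\hat\mu^{(j)}_a)};$$ if it has no solution, set $\hat\varepsilon^{(j)}_a=0$. Finally $\hat\varepsilon^*_a=\max_{1\le j\le 2\log n}\hat\varepsilon^{(j)}_a$. Definition of $W_n^+$ and $W_n^{++}$. For i.i.d. uniform$(0,1)$ variables $U_1,\dots,U_n$ let $V_n(t)=\frac1n\sum_{i=1}^n1_{\{U_i\le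 t\}}$ and $U_n(t)=\sqrt n\,[V_n(t)-t]$, $0<t<1$. Then $$W_n^+=\sup_{1/2\le t\le\Phi(\sqrt{2\log n})}\frac{|U_n(t)|}{\sqrt{t(1-t)}},$$ $$W_n^{++}=\sup\left\{\frac{|U_n(t)|}{\sqrt{t(1-t)}}:\ 0<t<1,\ F_n(0)-\frac{\sqrt{3\log n}}{\sqrt n}\le t\le\Phi(\sqrt{2\log n})\right\}.$$ In $W_n^{++}$ the uniform variables are $U_i=F(X_i)$, where $X_1,\dots,X_n$ is the sample with continuous c.d.f. $F$ and empirical c.d.f. $F_n$; thus the law of $W_n^{++}$, and hence the admissible $a_n$ in (ii), may depend on $F$. *)

theory Defs
  imports "HOL-Probability.Probability"
begin

abbreviation Phi :: "real \<Rightarrow> real"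
  where "Phi \<equiv> cdf std_normal_distribution"

text \<open>Samples of size \<open>n\<close> are indexed by \<open>{1..n}\<close>; independence includes measurability of each
  variable.\<close>

definition iid_with_cdf ::
    "'a measure \<Rightarrow> nat \<Rightarrow> (nat \<Rightarrow> 'a \<Rightarrow> real) \<Rightarrow> (real \<Rightarrow> real) \<Rightarrow> bool"
  where "iid_with_cdf M n X F \<longleftrightarrow>
    prob_space M \<and> prob_space.indep_vars M (\<lambda>_. borel) X {1..n} \<and>
    (\<forall>i\<in>{1..n}. cdf (distr M borel (X i)) = F)"

definition mixture_cdf :: "real \<Rightarrow> real measure \<Rightarrow> real \<Rightarrow> real"
  where "mixture_cdf \<epsilon> H t = (1 - \<epsilon>) * Phi t + \<epsilon> * (\<integral>\<mu>. Phi (t - \<mu>) \<partial>H)"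

definition mixture_sample ::
    "'a measure \<Rightarrow> nat \<Rightarrow> (nat \<Rightarrow> 'a \<Rightarrow> real) \<Rightarrow> real \<Rightarrow> real measure \<Rightarrow> bool"
  where "mixture_sample M n X \<epsilon> H \<longleftrightarrow>
    0 \<le> \<epsilon> \<and> \<epsilon> \<le> 1 \<and> real_distribution H \<and> iid_with_cdf M n X (mixture_cdf \<epsilon> H)"

definition emp_cdf :: "nat \<Rightarrow> (nat \<Rightarrow> real) \<Rightarrow> real \<Rightarrow> real"
  where "emp_cdf n x t = real (card {i\<in>{1..n}. x i \<le> t}) / real n"


subsection \<open>The estimator\<close>

text \<open>The two solutions \<open>y\<close> of \<open>sqrt n * \<bar>F\<^sub>n(t) - y\<bar> = a * sqrt (y * (1 - y))\<close>.\<close>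

definition F_upper :: "nat \<Rightarrow> real \<Rightarrow> (nat \<Rightarrow> real) \<Rightarrow> real \<Rightarrow> real"
  where "F_upper n a x t =
    (2 * emp_cdf n x t + a\<^sup>2 / n
      + a / sqrt n * sqrt (a\<^sup>2 / n + 4 * emp_cdf n x t - 4 * (emp_cdf n x t)\<^sup>2))
    / (2 * (1 + a\<^sup>2 / n))"

definition F_lower :: "nat \<Rightarrow> real \<Rightarrow> (nat \<Rightarrow> real) \<Rightarrow> real \<Rightarrow> real"
  where "F_lower n a x t =
    (2 * emp_cdf n x t + a\<^sup>2 / n
      - a / sqrt n * sqrt (a\<^sup>2 / n + 4 * emp_cdf n x t - 4 * (emp_cdf n x t)\<^sup>2))
    / (2 * (1 + a\<^sup>2 / n))"

definition D_ratio :: "real \<Rightarrow> real \<Rightarrow> real \<Rightarrow> real"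
  where "D_ratio \<mu> \<tau> \<tau>' = (Phi \<tau> - Phi (\<tau> - \<mu>)) / (Phi \<tau>' - Phi (\<tau>' - \<mu>))"

definition grid :: "nat \<Rightarrow> nat \<Rightarrow> real"
  where "grid n j = (real j - 1) / sqrt (2 * ln n)"

text \<open>If the denominator on the right-hand side vanishes, the quotient is \<open>0\<close> by convention;
  since \<open>D_ratio\<close> is positive for \<open>\<mu> > 0\<close>, the equation then has no solution.\<close>

definition is_mu_hat :: "nat \<Rightarrow> real \<Rightarrow> (nat \<Rightarrow> real) \<Rightarrow> nat \<Rightarrow> real \<Rightarrow> bool"
  where "is_mu_hat n a x j \<mu> \<longleftrightarrow> \<mu> > 0 \<and>
    D_ratio \<mu> (grid n j) (grid n (j + 1)) =
      (Phi (grid n j) - F_upper n a x (grid n j)) /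
      (Phi (grid n (j + 1)) - F_lower n a x (grid n (j + 1)))"

text \<open>A solution is unique because \<open>D_ratio\<close> is strictly decreasing in \<open>\<mu> > 0\<close>.\<close>

definition eps_hat_at :: "nat \<Rightarrow> real \<Rightarrow> (nat \<Rightarrow> real) \<Rightarrow> nat \<Rightarrow> real"
  where "eps_hat_at n a x j =
    (if \<exists>\<mu>. is_mu_hat n a x j \<mu>
     then (Phi (grid n j) - F_upper n a x (grid n j)) /
          (Phi (grid n j) - Phi (grid n j - (THE \<mu>. is_mu_hat n a x j \<mu>)))
     else 0)"

definition eps_hat :: "nat \<Rightarrow> real \<Rightarrow> (nat \<Rightarrow> real) \<Rightarrow> real"
  where "eps_hat n a x = (MAX j\<in>{j. 1 \<le> j \<and> real j \<le> 2 * ln n}. eps_hat_at n a x j)"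


subsection \<open>The weighted empirical process\<close>

definition emp_process :: "nat \<Rightarrow> (nat \<Rightarrow> real) \<Rightarrow> real \<Rightarrow> real"
  where "emp_process n u t = sqrt n * (emp_cdf n u t - t)"

text \<open>The suprema are taken in the extended reals, where they always exist.\<close>

definition W_plus :: "nat \<Rightarrow> (nat \<Rightarrow> real) \<Rightarrow> ereal"
  where "W_plus n u =
    (SUP t\<in>{1/2..Phi (sqrt (2 * ln n))}. ereal (\<bar>emp_process n u t\<bar> / sqrt (t * (1 - t))))"

definition W_plusplus :: "nat \<Rightarrow> (real \<Rightarrow> real) \<Rightarrow> (nat \<Rightarrow> real) \<Rightarrow> ereal"
  where "W_plusplus n F x =
    (SUP t\<in>{t. 0 < t \<and> t < 1 \<and>
               emp_cdf n x 0 - sqrt (3 * ln n) / sqrt n \<le> t \<and> t \<le> Phi (sqrt (2 * ln n))}.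
      ereal (\<bar>emp_process n (\<lambda>i. F (x i)) t\<bar> / sqrt (t * (1 - t))))"

end

theory Submission
  imports Defs
begin

text \<open>
  The proof separates a deterministic statement from the calibration of a confidence band.

  Deterministically, the estimator does not exceed the mixing weight \<open>\<epsilon>\<close> as soon as the true c.d.f. \<open>F\<close>
  lies in the band \<open>[F_lower, F_upper]\<close> at every grid point it uses (\<open>eps_hat_le\<close>). For two points \<open>\<tau> < \<tau>'\<close> the
  pair \<open>(Phi \<tau>' - F \<tau>', Phi \<tau> - F \<tau>)\<close> is \<open>\<epsilon>\<close> times an average over \<open>H\<close> of the points
  \<open>(Phi \<tau>' - Phi (\<tau>' - \<mu>), Phi \<tau> - Phi (\<tau> - \<mu>))\<close>. These points run along a strictly concave curve through the
  origin, because the quotient of the densities at \<open>\<tau> - \<mu>\<close> and \<open>\<tau>' - \<mu>\<close> decreases in \<open>\<mu>\<close>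
  (\<open>gap_tangent\<close>). The estimator writes its observed pair as a multiple \<open>s\<close> of one point of the curve.
  The band errs in such a way that the observed pair lies to the lower right of the true one, and
  concavity then forces \<open>s \<le> \<epsilon>\<close> (\<open>scale_le_mixing_weight\<close>).

  The band holds at a point \<open>t\<close> when the weighted empirical process of the variables \<open>F (X i)\<close> at \<open>F t\<close> is
  below \<open>a\<close> (\<open>quadratic_band\<close>). The mixture c.d.f. is continuous and strictly increasing, so the
  variables \<open>F (X i)\<close> are independent and uniform. It remains to see that the values of \<open>F\<close> at these grid points are
  in the ranges over which the suprema are taken.

  If \<open>H\<close> lives on \<open>(0, sqrt (2 * ln n)]\<close>, then at these grid points \<open>F\<close> lies between \<open>Phi (- sqrt (2 * ln n))\<close>
  and \<open>Phi (sqrt (2 * ln n))\<close>. Values of at least \<open>1/2\<close> are covered by \<open>W_plus\<close> of the sample \<open>F (X i)\<close>, the others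
  by \<open>W_plus\<close> of the reflected uniform sample \<open>1 - F (X i)\<close>; each of the two fails with probability at most
  \<open>\<alpha> / 2\<close> (\<open>coverage_compact\<close>).

  If \<open>H\<close> lives on \<open>(0, \<infinity>)\<close>, only the lower end of the range of \<open>W_plusplus\<close> is in question. It is below
  \<open>F 0\<close> unless the empirical c.d.f. at \<open>0\<close> exceeds its mean by \<open>sqrt (3 * ln n / n)\<close>, which by Hoeffding's
  inequality has probability at most \<open>1 / n ^ 6\<close>, uniformly in the mixture (\<open>coverage_half_line\<close>).

  The suprema are over uncountable sets and the estimator involves the solution of an equation, so
  the measurability of the events is part of the argument. It rests on right-continuity of the
  empirical process and on the countable range of the empirical c.d.f. at a fixed point.
\<close>

section \<open>The standard normal c.d.f.\<close>

lemma cdf_normal_interval: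
  assumes "y \<le> x"
  shows "Phi x = Phi y + integral {y..x} std_normal_density"
proof (cases "y = x")
  case False
  interpret N: real_distribution std_normal_distribution by (rule real_dist_normal_dist)
  have c: "continuous_on {y..x} std_normal_density"
    unfolding normal_density_def by (intro continuous_intros) auto
  have "Phi x - Phi y = measure std_normal_distribution {y<..x}"
    using N.cdf_diff_eq[of y x] assms False by simp
  also have "\<dots> = (\<integral>z. indicator {y<..x} z \<partial>std_normal_distribution)"
    by simp
  also have "\<dots> = (\<integral>z. std_normal_density z * indicator {y<..x} z \<partial>lborel)"
    by (subst integral_density) (auto simp: normal_density_nonneg)
  also have "\<dots> = (\<integral>z. std_normal_density z * indicator {y..x} z \<partial>lborel)"
    by (intro integral_cong_AE) (auto intro!: AE_I[where N="{y}"] simp: indicator_def)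
  also have "\<dots> = (LINT z:{y..x}|lborel. std_normal_density z)"
    unfolding set_lebesgue_integral_def by (simp add: mult.commute)
  also have "\<dots> = integral {y..x} std_normal_density"
    by (intro set_borel_integral_eq_integral borel_integrable_atLeastAtMost' c)
  finally show ?thesis by simp
qed simp

lemma DERIV_Phi: "(Phi has_real_derivative std_normal_density x) (at x)"
proof -
  have c: "continuous_on {x-1..x+1} std_normal_density"
    unfolding normal_density_def by (intro continuous_intros) auto
  have "((\<lambda>z. Phi (x-1) + integral {x-1..z} std_normal_density) has_real_derivative
      0 + std_normal_density x) (at x within {x-1..x+1})"
    by (intro derivative_intros integral_has_real_derivative c) auto
  then have "((\<lambda>z. Phi (x-1) + integral {x-1..z} std_normal_density) has_real_derivative
      std_normal_density x) (at x within {x-1..x+1})" by simp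
  then have "(Phi has_real_derivative std_normal_density x) (at x within {x-1..x+1})"
  proof (rule has_field_derivative_transform_within[OF _ zero_less_one])
    show "Phi (x-1) + integral {x-1..z} std_normal_density = Phi z" if "z \<in> {x-1..x+1}" for z
      using that by (intro cdf_normal_interval[symmetric]) simp
  qed simp
  then show ?thesis
    by (subst (asm) at_within_interior) auto
qed

lemma DERIV_Phi_chain [derivative_intros]:
  assumes "(f has_real_derivative f') (at x within S)"
  shows "((\<lambda>x. Phi (f x)) has_real_derivative std_normal_density (f x) * f') (at x within S)"
  using DERIV_chain2[OF DERIV_Phi assms] .

lemma Phi_strict_mono: "x < y \<Longrightarrow> Phi x < Phi y"
  using DERIV_pos_imp_increasing[of x y Phi] DERIV_Phi normal_density_pos[of 1 0] by (meson zero_less_one)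

lemma Phi_mono: "x \<le> y \<Longrightarrow> Phi x \<le> Phi y"
  using Phi_strict_mono[of x y] by (cases "x = y") auto

lemma Phi_le_1: "Phi x \<le> 1" and Phi_nonneg: "0 \<le> Phi x"
proof -
  interpret N: real_distribution std_normal_distribution by (rule real_dist_normal_dist)
  show "Phi x \<le> 1" by (rule N.cdf_bounded_prob)
  show "0 \<le> Phi x" by (rule N.cdf_nonneg)
qed

lemma Phi_less_1: "Phi x < 1"
  using Phi_strict_mono[of x "x+1"] Phi_le_1[of "x+1"] by simp

lemma Phi_borel [measurable]: "Phi \<in> borel_measurable borel"
  by (rule borel_measurable_mono) (auto simp: mono_def Phi_mono)

lemma isCont_Phi: "isCont Phi x"
  using DERIV_Phi by (rule DERIV_isCont)

text \<open>The derivative of \<open>Phi x + Phi (- x)\<close> vanishes because the density is even, and the limit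
  at infinity gives the value of the constant.\<close>
lemma Phi_minus: "Phi (- x) = 1 - Phi x"
proof -
  interpret N: real_distribution std_normal_distribution by (rule real_dist_normal_dist)
  have "((\<lambda>x. Phi x + Phi (- x)) has_real_derivative 0) (at z)" for z
  proof -
    have "((\<lambda>x. Phi x + Phi (- x)) has_real_derivative
        std_normal_density z + std_normal_density (- z) * (- 1)) (at z)"
      by (intro DERIV_add DERIV_Phi DERIV_Phi_chain DERIV_minus DERIV_ident)
    moreover have "std_normal_density (- z) = std_normal_density z"
      by (simp add: std_normal_density_def)
    ultimately show ?thesis by simp
  qed
  then have "Phi z + Phi (- z) = Phi x + Phi (- x)" for z
    using DERIV_const_ratio_const[of z x "\<lambda>x. Phi x + Phi (- x)" 0] by (cases "z = x") auto
  then have const: "(\<lambda>z. Phi z + Phi (- z)) = (\<lambda>_. Phi x + Phi (- x))" by auto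
  have "((\<lambda>z. Phi z + Phi (- z)) \<longlongrightarrow> 1 + 0) at_top"
    by (intro tendsto_add N.cdf_lim_at_top_prob
        filterlim_compose[OF N.cdf_lim_at_bot filterlim_uminus_at_bot_at_top])
  then have "Phi x + Phi (- x) = 1"
    unfolding const by (simp add: tendsto_const_iff)
  then show ?thesis by simp
qed

section \<open>Two-point inversion of normal mixtures\<close>

definition normal_gap :: "real \<Rightarrow> real \<Rightarrow> real"
  where "normal_gap \<tau> \<mu> = Phi \<tau> - Phi (\<tau> - \<mu>)"

lemma normal_gap_pos: "0 < \<mu> \<Longrightarrow> 0 < normal_gap \<tau> \<mu>"
  by (simp add: normal_gap_def Phi_strict_mono)

text \<open>The quotient of the normal densities at \<open>\<tau> - \<mu>\<close> and \<open>\<tau>' - \<mu>\<close>, hence the slope at parameter \<open>\<mu>\<close>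
  of the curve \<open>\<mu> \<mapsto> (normal_gap \<tau>' \<mu>, normal_gap \<tau> \<mu>)\<close>.\<close>
definition gap_slope :: "real \<Rightarrow> real \<Rightarrow> real \<Rightarrow> real"
  where "gap_slope \<tau> \<tau>' \<mu> = exp ((\<tau>' - \<mu>)\<^sup>2 / 2 - (\<tau> - \<mu>)\<^sup>2 / 2)"

lemma gap_slope: "std_normal_density (\<tau> - \<mu>) = gap_slope \<tau> \<tau>' \<mu> * std_normal_density (\<tau>' - \<mu>)"
  by (simp add: gap_slope_def std_normal_density_def exp_add[symmetric])

lemma gap_slope_less:
  assumes "\<tau> < \<tau>'" "\<mu> < \<nu>"
  shows "gap_slope \<tau> \<tau>' \<nu> < gap_slope \<tau> \<tau>' \<mu>"
proof -
  have "(\<tau>' - \<tau>) * (\<nu> - \<mu>) > 0" using assms by simp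
  then show ?thesis
    by (simp add: gap_slope_def power2_eq_square field_simps)
qed

text \<open>The curve \<open>\<mu> \<mapsto> (normal_gap \<tau>' \<mu>, normal_gap \<tau> \<mu>)\<close> moves to the right with a slope that strictly
  decreases in \<open>\<mu>\<close> when \<open>\<tau> < \<tau>'\<close>. It is therefore the graph of a strictly concave function and lies
  below each of its tangents.\<close>
lemma gap_tangent:
  assumes "\<tau> < \<tau>'" "\<mu> \<noteq> m"
  shows "normal_gap \<tau> \<mu> - normal_gap \<tau> m < gap_slope \<tau> \<tau>' m * (normal_gap \<tau>' \<mu> - normal_gap \<tau>' m)"
proof -
  \<comment> \<open>The height of the curve relative to the tangent direction at \<open>m\<close>; it peaks exactly at \<open>m\<close>.\<close>
  define \<psi> where "\<psi> \<mu> = normal_gap \<tau> \<mu> - gap_slope \<tau> \<tau>' m * normal_gap \<tau>' \<mu>" for \<mu>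
  have der: "(\<psi> has_real_derivative
      (gap_slope \<tau> \<tau>' z - gap_slope \<tau> \<tau>' m) * std_normal_density (\<tau>' - z)) (at z)" for z
    unfolding \<psi>_def normal_gap_def
    by (auto intro!: derivative_eq_intros simp: gap_slope[of \<tau> _ \<tau>'] algebra_simps)
  have pos: "std_normal_density z > 0" for z by (simp add: normal_density_pos)
  have "\<psi> \<mu> < \<psi> m"
  proof (cases "\<mu> < m")
    case True
    then show ?thesis
    proof (rule DERIV_pos_imp_increasing_open)
      show "\<exists>y. DERIV \<psi> z :> y \<and> y > 0" if "\<mu> < z" "z < m" for z
        using der[of z] gap_slope_less[OF assms(1) \<open>z < m\<close>] pos[of "\<tau>' - z"] by (auto intro!: exI)
      show "continuous_on {\<mu>..m} \<psi>"
        using der by (auto intro!: continuous_at_imp_continuous_on DERIV_isCont)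
    qed
  next
    case False
    then have "m < \<mu>" using assms by simp
    then show ?thesis
    proof (rule DERIV_neg_imp_decreasing_open)
      show "\<exists>y. DERIV \<psi> z :> y \<and> y < 0" if "m < z" "z < \<mu>" for z
        using der[of z] gap_slope_less[OF assms(1) \<open>m < z\<close>] pos[of "\<tau>' - z"]
        by (auto intro!: exI mult_neg_pos)
      show "continuous_on {m..\<mu>} \<psi>"
        using der by (auto intro!: continuous_at_imp_continuous_on DERIV_isCont)
    qed
  qed
  then show ?thesis by (simp add: \<psi>_def algebra_simps)
qed

text \<open>The curve passes through the origin at parameter \<open>0\<close>, so the chord from the origin to the
  point at \<open>m\<close> is steeper than the tangent there.\<close>
lemma gap_tangent_0:
  assumes "\<tau> < \<tau>'" "0 < m"
  shows "gap_slope \<tau> \<tau>' m * normal_gap \<tau>' m < normal_gap \<tau> m"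
  using gap_tangent[OF assms(1), of 0 m] assms(2) by (simp add: normal_gap_def algebra_simps)

text \<open>\<open>D_ratio\<close> is the slope of the chord from the origin to a point of the concave curve, and
  such slopes decrease as the point moves away from the origin.\<close>
lemma D_ratio_strict_decreasing:
  assumes "\<tau> < \<tau>'" "0 < \<mu>" "\<mu> < \<nu>"
  shows "D_ratio \<nu> \<tau> \<tau>' < D_ratio \<mu> \<tau> \<tau>'"
proof -
  let ?A = "normal_gap \<tau>" and ?B = "normal_gap \<tau>'" and ?r = "gap_slope \<tau> \<tau>' \<mu>"
  have posB: "?B \<mu> > 0" "?B \<nu> > 0" using assms by (auto intro!: normal_gap_pos)
  have lt: "?B \<mu> < ?B \<nu>" using assms by (simp add: normal_gap_def Phi_strict_mono)
  have "(?A \<nu> - ?A \<mu>) * ?B \<mu> < ?r * (?B \<nu> - ?B \<mu>) * ?B \<mu>"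
    using gap_tangent[OF assms(1), of \<nu> \<mu>] assms posB by simp
  also have "\<dots> = (?r * ?B \<mu>) * (?B \<nu> - ?B \<mu>)" by simp
  also have "\<dots> < ?A \<mu> * (?B \<nu> - ?B \<mu>)"
    using gap_tangent_0[OF assms(1,2)] lt by simp
  finally have "?A \<nu> * ?B \<mu> < ?A \<mu> * ?B \<nu>" by (simp add: algebra_simps)
  then show ?thesis
    using posB by (simp add: D_ratio_def normal_gap_def field_simps)
qed

context
  fixes H :: "real measure"
  assumes H: "real_distribution H"
begin

interpretation H: real_distribution H by (rule H)

lemma integrable_Phi_shift: "integrable H (\<lambda>\<mu>. Phi (t - \<mu>))"
  by (intro H.integrable_const_bound[where B=1] AE_I2)
     (auto simp: Phi_nonneg Phi_le_1)

lemma integral_normal_gap: "Phi t - mixture_cdf \<epsilon> H t = \<epsilon> * (\<integral>\<mu>. normal_gap t \<mu> \<partial>H)"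
  using H.prob_space
  by (simp add: mixture_cdf_def normal_gap_def Bochner_Integration.integral_diff
      integrable_Phi_shift algebra_simps)

text \<open>The point \<open>(Phi \<tau>' - F \<tau>', Phi \<tau> - F \<tau>)\<close> is \<open>\<epsilon>\<close> times an average of points of the concave curve, so
  it lies on or below the line through \<open>\<epsilon>\<close> times the curve point at \<open>m\<close> that is parallel to the
  tangent there (Jensen). The hypotheses place \<open>s\<close> times the curve point at \<open>m\<close> weakly to the lower
  right of it, so on or below the same line. If \<open>s\<close> exceeded \<open>\<epsilon>\<close>, the ray from the origin through the
  curve point would not rise above the line between its multiples by \<open>\<epsilon>\<close> and by \<open>s\<close>, although the
  ray is strictly steeper.\<close>
lemma scale_le_mixing_weight:
  assumes "\<tau> < \<tau>'" "0 < m" "0 \<le> \<epsilon>"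
    and A: "s * normal_gap \<tau> m \<le> Phi \<tau> - mixture_cdf \<epsilon> H \<tau>"
    and B: "Phi \<tau>' - mixture_cdf \<epsilon> H \<tau>' \<le> s * normal_gap \<tau>' m"
  shows "s \<le> \<epsilon>"
proof (rule ccontr)
  assume "\<not> s \<le> \<epsilon>"
  let ?A = "normal_gap \<tau>" and ?B = "normal_gap \<tau>'" and ?r = "gap_slope \<tau> \<tau>' m"
  have int: "integrable H (normal_gap t)" for t
    using integrable_Phi_shift by (simp add: normal_gap_def[abs_def])
  have r: "0 \<le> ?r" by (simp add: gap_slope_def)
  have tangent: "?A \<mu> \<le> ?A m + ?r * (?B \<mu> - ?B m)" for \<mu>
    using gap_tangent[OF assms(1), of \<mu> m] by (cases "\<mu> = m") auto
  have "(\<integral>\<mu>. ?A \<mu> \<partial>H) \<le> (\<integral>\<mu>. ?A m + ?r * (?B \<mu> - ?B m) \<partial>H)"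
    using int by (intro integral_mono tangent) auto
  also have "\<dots> = ?A m + ?r * ((\<integral>\<mu>. ?B \<mu> \<partial>H) - ?B m)"
    using H.prob_space int by simp
  finally have "\<epsilon> * (\<integral>\<mu>. ?A \<mu> \<partial>H) \<le> \<epsilon> * (?A m + ?r * ((\<integral>\<mu>. ?B \<mu> \<partial>H) - ?B m))"
    using assms by (intro mult_left_mono)
  also have "\<dots> = \<epsilon> * ?A m + ?r * (\<epsilon> * (\<integral>\<mu>. ?B \<mu> \<partial>H) - \<epsilon> * ?B m)"
    by (simp add: algebra_simps)
  also have "\<dots> \<le> \<epsilon> * ?A m + ?r * (s * ?B m - \<epsilon> * ?B m)"
    using B r by (simp add: integral_normal_gap mult_left_mono)
  finally have "s * ?A m \<le> \<epsilon> * ?A m + ?r * (s * ?B m - \<epsilon> * ?B m)"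
    using A by (simp add: integral_normal_gap)
  then have "(s - \<epsilon>) * ?A m \<le> (s - \<epsilon>) * (?r * ?B m)" by (simp add: algebra_simps)
  then show False
    using gap_tangent_0[OF assms(1,2)] \<open>\<not> s \<le> \<epsilon>\<close> by simp
qed

end

section \<open>The estimator on a confidence band\<close>

lemma grid_less: 
  assumes "n \<ge> 2" shows "grid n j < grid n (j + 1)"
  using assms by (simp add: grid_def divide_strict_right_mono)

lemma is_mu_hat_unique:
  assumes "n \<ge> 2" "is_mu_hat n a x j \<mu>" "is_mu_hat n a x j \<nu>"
  shows "\<mu> = \<nu>"
  using D_ratio_strict_decreasing[OF grid_less[OF assms(1), of j], of \<mu> \<nu>]
    D_ratio_strict_decreasing[OF grid_less[OF assms(1), of j], of \<nu> \<mu>] assms(2,3)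
  by (cases \<mu> \<nu> rule: linorder_cases) (auto simp: is_mu_hat_def)

text \<open>The estimate \<open>s\<close> and the solution \<open>\<mu>\<close> satisfy \<open>A = s * normal_gap \<tau> \<mu>\<close> and
  \<open>B = s * normal_gap \<tau>' \<mu>\<close> for consecutive grid points \<open>\<tau> < \<tau>'\<close>, where \<open>A\<close> uses the upper end of the band and \<open>B\<close> the lower end. Inside the band, \<open>A\<close> underestimates \<open>Phi - F\<close> at the first
  point and \<open>B\<close> overestimates it at the second, which is the situation of
  \<open>scale_le_mixing_weight\<close>.\<close>
lemma eps_hat_at_le:
  assumes n: "n \<ge> 2" and H: "real_distribution H" and \<epsilon>: "0 \<le> \<epsilon>"
    and upper: "mixture_cdf \<epsilon> H (grid n j) \<le> F_upper n a x (grid n j)"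
    and lower: "F_lower n a x (grid n (j + 1)) \<le> mixture_cdf \<epsilon> H (grid n (j + 1))"
  shows "eps_hat_at n a x j \<le> \<epsilon>"
proof (cases "\<exists>\<mu>. is_mu_hat n a x j \<mu>")
  case True
  then obtain m where m: "is_mu_hat n a x j m" by blast
  let ?t = "grid n j" and ?t' = "grid n (j + 1)"
  have The: "(THE \<mu>. is_mu_hat n a x j \<mu>) = m"
    using m is_mu_hat_unique[OF n] by blast
  define A B where "A = Phi ?t - F_upper n a x ?t" and "B = Phi ?t' - F_lower n a x ?t'"
  have "m > 0" using m by (simp add: is_mu_hat_def)
  then have pos: "normal_gap ?t m > 0" "normal_gap ?t' m > 0" by (auto intro: normal_gap_pos)
  define s where "s = A / normal_gap ?t m"
  have eq: "normal_gap ?t m / normal_gap ?t' m = A / B"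
    using m by (simp add: is_mu_hat_def D_ratio_def normal_gap_def A_def B_def)
  \<comment> \<open>A zero denominator would make the right-hand quotient \<open>0\<close>, but the left-hand one is positive.\<close>
  have "B \<noteq> 0" using eq pos by auto
  have "s * normal_gap ?t m = A" using pos by (simp add: s_def)
  moreover have "s * normal_gap ?t' m = B"
    using eq pos \<open>B \<noteq> 0\<close> by (simp add: s_def field_simps)
  ultimately have "s \<le> \<epsilon>"
    using upper lower
    by (intro scale_le_mixing_weight[OF H grid_less[OF n] \<open>m > 0\<close> \<epsilon>, of s j])
       (simp_all add: A_def B_def)
  then show ?thesis
    using True by (simp add: eps_hat_at_def The s_def A_def normal_gap_def)
qed (use \<epsilon> in \<open>simp add: eps_hat_at_def\<close>)

text \<open>Squaring the hypothesis gives a quadratic inequality in \<open>y\<close> whose roots are the two band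
  ends. The hypothesis itself forces \<open>a > 0\<close>.\<close>
lemma quadratic_band:
  assumes n: "n > 0" and y: "0 < y" "y < 1"
    and lt: "\<bar>sqrt n * (emp_cdf n x t - y)\<bar> / sqrt (y * (1 - y)) < a"
  shows "F_lower n a x t \<le> y" "y \<le> F_upper n a x t"
proof -
  define p where "p = emp_cdf n x t"
  define c where "c = a\<^sup>2 / n"
  have w: "y * (1 - y) > 0" using y by simp
  have "a > 0" using lt by (smt (verit) divide_nonneg_nonneg real_sqrt_ge_zero w abs_ge_zero)
  have c: "c \<ge> 0" by (simp add: c_def)
  have "\<bar>sqrt n * (p - y)\<bar> < a * sqrt (y * (1 - y))"
    using lt w by (simp add: field_simps p_def)
  then have "(sqrt n * (p - y))\<^sup>2 \<le> (a * sqrt (y * (1 - y)))\<^sup>2"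
    by (metis less_imp_le power2_abs power_mono abs_ge_zero)
  then have "n * (p - y)\<^sup>2 \<le> a\<^sup>2 * (y * (1 - y))"
    using w by (simp add: power_mult_distrib)
  then have q: "(p - y)\<^sup>2 \<le> c * (y * (1 - y))"
    using n by (simp add: c_def field_simps)
  define d where "d = sqrt c * sqrt (c + 4 * p - 4 * p\<^sup>2)"
  \<comment> \<open>Completing the square in \<open>(1 + c) * y\<^sup>2 - (2 * p + c) * y + p\<^sup>2 \<le> 0\<close>.\<close>
  have "(2 * (1 + c) * y - (2 * p + c))\<^sup>2 =
      c * (c + 4 * p - 4 * p\<^sup>2) + 4 * (1 + c) * ((p - y)\<^sup>2 - c * (y * (1 - y)))"
    by (simp add: power2_eq_square algebra_simps)
  also have "\<dots> \<le> c * (c + 4 * p - 4 * p\<^sup>2)"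
    using q c by (simp add: mult_nonneg_nonpos)
  finally have "\<bar>2 * (1 + c) * y - (2 * p + c)\<bar> \<le> d"
    unfolding d_def by (metis real_sqrt_abs real_sqrt_le_mono real_sqrt_mult)
  moreover have "sqrt c = a / sqrt n" using \<open>a > 0\<close> by (simp add: c_def real_sqrt_divide)
  ultimately have "2 * p + c - a / sqrt n * sqrt (c + 4 * p - 4 * p\<^sup>2) \<le> y * (2 * (1 + c))"
      "y * (2 * (1 + c)) \<le> 2 * p + c + a / sqrt n * sqrt (c + 4 * p - 4 * p\<^sup>2)"
    by (auto simp: d_def abs_le_iff mult.commute)
  then show "F_lower n a x t \<le> y" "y \<le> F_upper n a x t"
    using c unfolding F_lower_def F_upper_def p_def[symmetric] c_def[symmetric]
    by (simp_all add: divide_le_eq le_divide_eq)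
qed

abbreviation grid_indices :: "nat \<Rightarrow> nat set"
  where "grid_indices n \<equiv> {j. 1 \<le> j \<and> real j \<le> 2 * ln n}"

lemma grid_indices:
  shows "finite (grid_indices n)" and "n \<ge> 2 \<Longrightarrow> grid_indices n \<noteq> {}"
proof -
  have "grid_indices n \<subseteq> {..nat \<lceil>2 * ln n\<rceil>}" by (auto simp: le_nat_iff le_ceiling_iff)
  then show "finite (grid_indices n)" by (rule finite_subset) simp
  assume "n \<ge> 2"
  \<comment> \<open>The index \<open>1\<close> is admissible because \<open>exp (1/2) \<le> 2\<close>.\<close>
  have "1 \<le> 2 * ln (real n)"
  proof -
    have "exp (1/2) \<le> (2::real)"
      using exp_bound_half[of "1/2 :: real"] by simp
    also have "\<dots> \<le> n" using \<open>n \<ge> 2\<close> by simp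
    finally have "1/2 \<le> ln (real n)" using \<open>n \<ge> 2\<close> by (subst ln_ge_iff) auto
    then show ?thesis by simp
  qed
  then show "grid_indices n \<noteq> {}" by (auto intro!: exI[of _ 1])
qed

lemma grid_bounds:
  assumes "n \<ge> 2" "j \<in> grid_indices n"
  shows "0 \<le> grid n j" "grid n (j + 1) \<le> sqrt (2 * ln n)"
proof -
  have pos: "2 * ln (real n) > 0" using assms(1) by simp
  show "0 \<le> grid n j" using assms by (simp add: grid_def)
  have "real j \<le> sqrt (2 * ln n) * sqrt (2 * ln n)" using assms pos by simp
  then show "grid n (j + 1) \<le> sqrt (2 * ln n)"
    using pos by (simp add: grid_def divide_le_eq)
qed

text \<open>The estimator evaluates the band only at grid points in \<open>[0, sqrt (2 * ln n)]\<close>: the largest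
  one is \<open>grid n (j + 1)\<close> for the last index \<open>j\<close>.\<close>
lemma eps_hat_le:
  assumes n: "n \<ge> 2" and H: "real_distribution H" and \<epsilon>: "0 \<le> \<epsilon>"
    and F: "\<And>t. 0 < mixture_cdf \<epsilon> H t" "\<And>t. mixture_cdf \<epsilon> H t < 1"
    and band: "\<And>t. 0 \<le> t \<Longrightarrow> t \<le> sqrt (2 * ln n) \<Longrightarrow> t \<in> range (grid n) \<Longrightarrow>
      \<bar>sqrt n * (emp_cdf n x t - mixture_cdf \<epsilon> H t)\<bar> /
        sqrt (mixture_cdf \<epsilon> H t * (1 - mixture_cdf \<epsilon> H t)) < a"
  shows "eps_hat n a x \<le> \<epsilon>"
proof -
  have "eps_hat_at n a x j \<le> \<epsilon>" if j: "j \<in> grid_indices n" for j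
  proof (rule eps_hat_at_le[OF n H \<epsilon>])
    have *: "0 \<le> grid n j" "grid n j \<le> sqrt (2 * ln n)"
        "0 \<le> grid n (j + 1)" "grid n (j + 1) \<le> sqrt (2 * ln n)"
      using grid_bounds[OF n j] grid_less[OF n, of j] by auto
    show "mixture_cdf \<epsilon> H (grid n j) \<le> F_upper n a x (grid n j)"
      using n * by (intro quadratic_band F band) auto
    show "F_lower n a x (grid n (j + 1)) \<le> mixture_cdf \<epsilon> H (grid n (j + 1))"
      using n * by (intro quadratic_band F band) auto
  qed
  then show ?thesis
    using grid_indices[of n] n by (auto simp: eps_hat_def)
qed


section \<open>Measurability of the suprema and of the estimator\<close>

definition weighted_dev :: "nat \<Rightarrow> (nat \<Rightarrow> real) \<Rightarrow> real \<Rightarrow> real"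
  where "weighted_dev n u t = \<bar>emp_process n u t\<bar> / sqrt (t * (1 - t))"

lemma W_plus_altdef:
  "W_plus n u = (SUP t\<in>{1/2..Phi (sqrt (2 * ln n))}. ereal (weighted_dev n u t))"
  by (simp add: W_plus_def weighted_dev_def)

lemma W_plusplus_altdef:
  "W_plusplus n F x =
    (SUP t\<in>{t. 0 < t \<and> t < 1 \<and> emp_cdf n x 0 - sqrt (3 * ln n) / sqrt n \<le> t \<and>
               t \<le> Phi (sqrt (2 * ln n))}. ereal (weighted_dev n (\<lambda>i. F (x i)) t))"
  by (simp add: W_plusplus_def weighted_dev_def)

lemma emp_cdf_cong: "(\<And>i. i \<in> {1..n} \<Longrightarrow> x i \<le> t \<longleftrightarrow> y i \<le> s) \<Longrightarrow> emp_cdf n x t = emp_cdf n y s"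
  unfolding emp_cdf_def by (intro arg_cong[where f="\<lambda>A. real (card A) / real n"]) auto

lemma emp_cdf_sum: "emp_cdf n x t = (\<Sum>i\<in>{1..n}. indicator {..t} (x i)) / n"
  by (simp add: emp_cdf_def indicator_def sum.If_cases Int_def)

lemma emp_cdf_right_continuous: "(emp_cdf n u \<longlongrightarrow> emp_cdf n u t) (at_right t)"
proof (rule tendsto_eventually)
  have "eventually (\<lambda>s. u i \<le> s \<longleftrightarrow> u i \<le> t) (at_right t)" for i
  proof (cases "u i \<le> t")
    case True
    then show ?thesis by (auto simp: eventually_at_filter)
  next
    case False
    then have "eventually (\<lambda>s. s < u i) (at_right t)"
      by (intro order_tendstoD(2)[OF tendsto_ident_at]) simp
    then show ?thesis using False by (auto elim: eventually_mono)
  qed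
  then have "eventually (\<lambda>s. \<forall>i\<in>{1..n}. u i \<le> s \<longleftrightarrow> u i \<le> t) (at_right t)"
    by (intro eventually_ball_finite) auto
  then show "eventually (\<lambda>s. emp_cdf n u s = emp_cdf n u t) (at_right t)"
    by (rule eventually_mono) (auto intro!: emp_cdf_cong)
qed

lemma weighted_dev_right_continuous:
  assumes "0 < t" "t < 1"
  shows "(weighted_dev n u \<longlongrightarrow> weighted_dev n u t) (at_right t)"
  unfolding weighted_dev_def emp_process_def
  using assms by (intro tendsto_intros emp_cdf_right_continuous) auto

text \<open>Right-continuity makes a supremum over an interval countable: a value above the supremum
  over the rationals would persist slightly to the right and so at some rational point. Only the
  right endpoint \<open>b\<close> has no rationals to its right and must be added by hand.\<close>
lemma SUP_right_continuous:
  fixes f :: "real \<Rightarrow> real"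
  assumes le: "\<And>t. t \<in> S \<Longrightarrow> t \<le> b" and up: "\<And>t u. t \<in> S \<Longrightarrow> t \<le> u \<Longrightarrow> u \<le> b \<Longrightarrow> u \<in> S"
    and cont: "\<And>t. t \<in> S \<Longrightarrow> (f \<longlongrightarrow> f t) (at_right t)"
  shows "(SUP t\<in>S. ereal (f t)) = (SUP t\<in>S \<inter> insert b \<rat>. ereal (f t))" (is "_ = ?R")
proof (rule antisym)
  show "(SUP t\<in>S. ereal (f t)) \<le> ?R"
  proof (rule SUP_least)
    fix t assume t: "t \<in> S"
    show "ereal (f t) \<le> ?R"
    proof (rule ccontr)
      assume "\<not> ereal (f t) \<le> ?R"
      then have less: "?R < ereal (f t)" by simp
      have "t \<noteq> b"
      proof
        assume "t = b"
        then have "ereal (f t) \<le> ?R" using t by (intro SUP_upper) auto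
        then show False using less by simp
      qed
      then have "t < b" using le[OF t] by simp
      have "((\<lambda>s. ereal (f s)) \<longlongrightarrow> ereal (f t)) (at_right t)"
        using cont[OF t] by simp
      then have "eventually (\<lambda>s. ?R < ereal (f s)) (at_right t)"
        using less by (rule order_tendstoD)
      then obtain d where d: "d > t" "\<And>s. t < s \<Longrightarrow> s < d \<Longrightarrow> ?R < ereal (f s)"
        by (auto simp: eventually_at_right_field)
      obtain s where s: "s \<in> \<rat>" "t < s" "s < min d b"
        using Rats_dense_in_real[of t "min d b"] d \<open>t < b\<close> by auto
      have "ereal (f s) \<le> ?R"
        using s up[OF t, of s] by (intro SUP_upper) auto
      with d(2)[of s] s show False by simp
    qed
  qed
  show "?R \<le> (SUP t\<in>S. ereal (f t))" by (rule SUP_subset_mono) auto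
qed

context
  fixes M :: "'a measure" and X :: "nat \<Rightarrow> 'a \<Rightarrow> real" and n :: nat
  assumes X [measurable]: "\<And>i. i \<in> {1..n} \<Longrightarrow> X i \<in> borel_measurable M"
begin

lemma measurable_emp_cdf: "(\<lambda>\<omega>. emp_cdf n (\<lambda>i. X i \<omega>) t) \<in> borel_measurable M"
  unfolding emp_cdf_sum
proof (intro borel_measurable_divide borel_measurable_sum)
  show "(\<lambda>\<omega>. indicator {..t} (X i \<omega>) :: real) \<in> borel_measurable M" if "i \<in> {1..n}" for i
    using X[OF that] by measurable
qed simp

lemma measurable_emp_cdf_range:
  "(\<lambda>\<omega>. emp_cdf n (\<lambda>i. X i \<omega>) t) \<in> M \<rightarrow>\<^sub>M count_space (range (\<lambda>k::nat. real k / real n))"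
  unfolding measurable_count_space_eq_countable[OF countable_image[OF countableI_type]]
proof (intro conjI ballI)
  show "(\<lambda>\<omega>. emp_cdf n (\<lambda>i. X i \<omega>) t) -` {c} \<inter> space M \<in> sets M" for c
    by (rule measurable_sets[OF measurable_emp_cdf]) simp
  show "(\<lambda>\<omega>. emp_cdf n (\<lambda>i. X i \<omega>) t) \<in> space M \<rightarrow> range (\<lambda>k::nat. real k / real n)"
    unfolding emp_cdf_def by (intro funcsetI rangeI)
qed

text \<open>The empirical c.d.f. at a fixed point has countably many values, so it may be substituted
  for a parameter of a measurable function without joint measurability. This covers both the random
  index set of \<open>W_plusplus\<close> and the discontinuous dependence of the estimator on the data.\<close>
lemma measurable_function_of_emp_cdf:
  assumes "\<And>c. f c \<in> M \<rightarrow>\<^sub>M N"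
  shows "(\<lambda>\<omega>. f (emp_cdf n (\<lambda>i. X i \<omega>) t) \<omega>) \<in> M \<rightarrow>\<^sub>M N"
proof (rule measurable_compose_countable'[where f=f and g="\<lambda>\<omega>. emp_cdf n (\<lambda>i. X i \<omega>) t"])
  show "countable (range (\<lambda>k::nat. real k / real n))" by (rule countable_image[OF countableI_type])
qed (rule assms measurable_emp_cdf_range)+

lemma measurable_SUP_weighted_dev:
  assumes le: "\<And>t. t \<in> S \<Longrightarrow> t \<le> b" and up: "\<And>t u. t \<in> S \<Longrightarrow> t \<le> u \<Longrightarrow> u \<le> b \<Longrightarrow> u \<in> S"
    and "S \<subseteq> {0<..<1}"
  shows "(\<lambda>\<omega>. SUP t\<in>S. ereal (weighted_dev n (\<lambda>i. X i \<omega>) t)) \<in> borel_measurable M"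
proof -
  have "(SUP t\<in>S. ereal (weighted_dev n u t)) = (SUP t\<in>S \<inter> insert b \<rat>. ereal (weighted_dev n u t))"
    for u
  proof (rule SUP_right_continuous[OF le up])
    fix t assume "t \<in> S"
    then have "t \<in> {0<..<1}" using assms(3) by (rule subsetD[rotated])
    then show "(weighted_dev n u \<longlongrightarrow> weighted_dev n u t) (at_right t)"
      by (intro weighted_dev_right_continuous) auto
  qed
  moreover have "(\<lambda>\<omega>. SUP t\<in>S \<inter> insert b \<rat>. ereal (weighted_dev n (\<lambda>i. X i \<omega>) t)) \<in> borel_measurable M"
  proof (rule borel_measurable_SUP)
    show "countable (S \<inter> insert b \<rat>)" by (intro countable_Int2 countable_insert countable_rat)
    show "(\<lambda>\<omega>. ereal (weighted_dev n (\<lambda>i. X i \<omega>) t)) \<in> borel_measurable M" for t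
      unfolding weighted_dev_def emp_process_def
      by (intro borel_measurable_ereal borel_measurable_divide borel_measurable_abs
          borel_measurable_times borel_measurable_diff measurable_emp_cdf) auto
  qed
  ultimately show ?thesis by simp
qed

lemma measurable_W_plus: "(\<lambda>\<omega>. W_plus n (\<lambda>i. X i \<omega>)) \<in> borel_measurable M"
  unfolding W_plus_altdef using Phi_less_1[of "sqrt (2 * ln n)"]
  by (intro measurable_SUP_weighted_dev[where b="Phi (sqrt (2 * ln n))"]) auto

lemma measurable_eps_hat_at: "(\<lambda>\<omega>. eps_hat_at n a (\<lambda>i. X i \<omega>) j) \<in> borel_measurable M"
proof -
  let ?t = "grid n j" and ?t' = "grid n (j + 1)"
  \<comment> \<open>The estimate depends on the data only through two values of the empirical c.d.f.; \<open>g\<close> evaluates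
    it at an arbitrary sample that has these values.\<close>
  define g where "g p q = eps_hat_at n a (SOME x. emp_cdf n x ?t = p \<and> emp_cdf n x ?t' = q) j" for p q
  have "eps_hat_at n a x j = g (emp_cdf n x ?t) (emp_cdf n x ?t')" for x
  proof -
    define y where "y = (SOME y. emp_cdf n y ?t = emp_cdf n x ?t \<and> emp_cdf n y ?t' = emp_cdf n x ?t')"
    have "emp_cdf n y ?t = emp_cdf n x ?t \<and> emp_cdf n y ?t' = emp_cdf n x ?t'"
      unfolding y_def by (rule someI[where x=x]) simp
    then have "eps_hat_at n a y j = eps_hat_at n a x j"
      by (simp only: eps_hat_at_def is_mu_hat_def F_upper_def F_lower_def)
    then show ?thesis by (simp add: g_def y_def)
  qed
  moreover have "(\<lambda>\<omega>. g (emp_cdf n (\<lambda>i. X i \<omega>) ?t) (emp_cdf n (\<lambda>i. X i \<omega>) ?t')) \<in> borel_measurable M"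
    by (intro measurable_function_of_emp_cdf[where f="\<lambda>p \<omega>. g p (emp_cdf n (\<lambda>i. X i \<omega>) ?t')"]
        measurable_function_of_emp_cdf[where f="\<lambda>q \<omega>. g p q" for p] measurable_const) simp
  ultimately show ?thesis by simp
qed

lemma measurable_eps_hat_le:
  assumes "n \<ge> 2"
  shows "{\<omega>\<in>space M. eps_hat n a (\<lambda>i. X i \<omega>) \<le> \<epsilon>} \<in> sets M"
proof -
  have "{\<omega>\<in>space M. eps_hat n a (\<lambda>i. X i \<omega>) \<le> \<epsilon>} =
      {\<omega>\<in>space M. \<forall>j\<in>grid_indices n. eps_hat_at n a (\<lambda>i. X i \<omega>) j \<le> \<epsilon>}"
    using grid_indices[of n] assms by (auto simp: eps_hat_def)
  also have "\<dots> \<in> sets M"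
    by (intro sets.sets_Collect_finite_All grid_indices borel_measurable_le measurable_eps_hat_at)
       simp
  finally show ?thesis .
qed

end

lemma measurable_W_plusplus:
  assumes X: "\<And>i. i \<in> {1..n} \<Longrightarrow> X i \<in> borel_measurable M"
    and F: "F \<in> borel_measurable borel"
  shows "(\<lambda>\<omega>. W_plusplus n F (\<lambda>i. X i \<omega>)) \<in> borel_measurable M"
  unfolding W_plusplus_altdef
proof (rule measurable_function_of_emp_cdf[OF X, where f="\<lambda>c \<omega>. SUP t\<in>{t. 0 < t \<and> t < 1 \<and> c - sqrt (3 * ln n) / sqrt n \<le> t \<and>
               t \<le> Phi (sqrt (2 * ln n))}. ereal (weighted_dev n (\<lambda>i. F (X i \<omega>)) t)"])
  show "(\<lambda>\<omega>. SUP t\<in>{t. 0 < t \<and> t < 1 \<and> c - sqrt (3 * ln n) / sqrt n \<le> t \<and>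
      t \<le> Phi (sqrt (2 * ln n))}. ereal (weighted_dev n (\<lambda>i. F (X i \<omega>)) t)) \<in> borel_measurable M" for c
    using Phi_less_1[of "sqrt (2 * ln n)"] measurable_compose[OF X F]
    by (intro measurable_SUP_weighted_dev[where b="Phi (sqrt (2 * ln n))"]) auto
qed

section \<open>Laws of samples and their transforms\<close>

lemma iid_with_cdf_measurable:
  assumes "iid_with_cdf M n X F" "i \<in> {1..n}"
  shows "X i \<in> borel_measurable M"
proof -
  interpret prob_space M using assms(1) by (simp add: iid_with_cdf_def)
  show ?thesis using assms by (auto simp: iid_with_cdf_def indep_vars_def)
qed

lemma iid_with_cdf_distr:
  assumes "iid_with_cdf M n X F" "i \<in> {1..n}"
  shows "real_distribution (distr M borel (X i))" "cdf (distr M borel (X i)) = F"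
proof -
  interpret prob_space M using assms(1) by (simp add: iid_with_cdf_def)
  show "real_distribution (distr M borel (X i))"
    using iid_with_cdf_measurable[OF assms] by (rule real_distribution_distr)
  show "cdf (distr M borel (X i)) = F" using assms by (simp add: iid_with_cdf_def)
qed

lemma iid_with_cdf_joint_distr:
  assumes X: "iid_with_cdf M n X F" and Y: "iid_with_cdf N n Y F" and n: "n \<ge> 1"
  shows "distr M (PiM {1..n} (\<lambda>_. borel)) (\<lambda>\<omega>. \<lambda>i\<in>{1..n}. X i \<omega>) =
    distr N (PiM {1..n} (\<lambda>_. borel)) (\<lambda>\<omega>. \<lambda>i\<in>{1..n}. Y i \<omega>)"
proof -
  interpret M: prob_space M using X by (simp add: iid_with_cdf_def)
  interpret N: prob_space N using Y by (simp add: iid_with_cdf_def)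
  have "distr M (PiM {1..n} (\<lambda>_. borel)) (\<lambda>\<omega>. \<lambda>i\<in>{1..n}. X i \<omega>) =
      PiM {1..n} (\<lambda>i. distr M borel (X i))"
    using X n iid_with_cdf_measurable[OF X]
    by (subst (asm) iid_with_cdf_def, subst (asm) M.indep_vars_iff_distr_eq_PiM') auto
  also have "\<dots> = PiM {1..n} (\<lambda>i. distr N borel (Y i))"
  proof (rule PiM_cong)
    fix i assume "i \<in> {1..n}"
    then show "distr M borel (X i) = distr N borel (Y i)"
      using iid_with_cdf_distr[OF X] iid_with_cdf_distr[OF Y] by (intro cdf_unique) auto
  qed simp
  also have "\<dots> = distr N (PiM {1..n} (\<lambda>_. borel)) (\<lambda>\<omega>. \<lambda>i\<in>{1..n}. Y i \<omega>)"
    using Y n iid_with_cdf_measurable[OF Y]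
    by (subst (asm) iid_with_cdf_def, subst (asm) N.indep_vars_iff_distr_eq_PiM') auto
  finally show ?thesis .
qed

lemma W_plus_restrict: "W_plus n (\<lambda>i\<in>{1..n}. u i) = W_plus n u"
proof -
  have "emp_cdf n (\<lambda>i\<in>{1..n}. u i) = emp_cdf n u" by (intro ext emp_cdf_cong) auto
  then show ?thesis by (simp add: W_plus_def emp_process_def)
qed

text \<open>A calibration of the critical value on one probability space transfers to every other one:
  \<open>W_plus\<close> is a measurable function of the sample, whose joint law is determined by the marginal
  c.d.f.\<close>
lemma prob_W_plus_cong:
  assumes X: "iid_with_cdf M n X F" and Y: "iid_with_cdf N n Y F" and n: "n \<ge> 1"
  shows "\<P>(\<omega> in M. W_plus n (\<lambda>i. X i \<omega>) \<ge> c) = \<P>(\<omega> in N. W_plus n (\<lambda>i. Y i \<omega>) \<ge> c)"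
proof -
  let ?P = "PiM {1..n} (\<lambda>_. borel :: real measure)"
  let ?S = "{u\<in>space ?P. W_plus n u \<ge> c}"
  have "(\<lambda>u. W_plus n (\<lambda>i. u i)) \<in> borel_measurable ?P"
    by (rule measurable_W_plus) simp
  then have S: "?S \<in> sets ?P" by simp
  have *: "\<P>(\<omega> in M. W_plus n (\<lambda>i. X i \<omega>) \<ge> c) =
      measure (distr M ?P (\<lambda>\<omega>. \<lambda>i\<in>{1..n}. X i \<omega>)) ?S"
    if X: "iid_with_cdf M n X F" for M :: "'x measure" and X
  proof -
    have "(\<lambda>\<omega>. \<lambda>i\<in>{1..n}. X i \<omega>) \<in> M \<rightarrow>\<^sub>M ?P"
      using iid_with_cdf_measurable[OF X] by (rule measurable_restrict)
    then show ?thesis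
      using S by (subst measure_distr)
        (auto intro!: arg_cong[where f="measure M"] simp: W_plus_restrict[unfolded One_nat_def] space_PiM)
  qed
  show ?thesis
    using *[OF X] *[OF Y] iid_with_cdf_joint_distr[OF X Y n] by simp
qed


lemma cdf_uniform:
  "cdf (uniform_measure lborel {0<..<1}) x = (if x \<le> 0 then 0 else if 1 \<le> x then 1 else x)"
proof -
  have "{0<..<1} \<inter> {..x} = (if x \<le> 0 then {} else if 1 \<le> x then {0<..<1} else {0<..x})"
    by auto
  then show ?thesis by (simp add: cdf_def measure_uniform_measure)
qed

lemma real_distribution_uniform: "real_distribution (uniform_measure lborel {0<..<1::real})"
proof -
  interpret prob_space "uniform_measure lborel {0<..<1::real}"
    by (rule prob_space_uniform_measure) auto
  show ?thesis by unfold_locales simp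
qed

lemma iid_with_cdf_compose:
  assumes X: "iid_with_cdf M n X F" and f: "f \<in> borel_measurable borel"
    and G: "\<And>i u. i \<in> {1..n} \<Longrightarrow> \<P>(\<omega> in M. f (X i \<omega>) \<le> u) = G u"
  shows "iid_with_cdf M n (\<lambda>i \<omega>. f (X i \<omega>)) G"
proof -
  interpret prob_space M using X by (simp add: iid_with_cdf_def)
  have "indep_vars (\<lambda>_. borel) (\<lambda>i \<omega>. f (X i \<omega>)) {1..n}"
    using X f by (auto simp: iid_with_cdf_def intro: indep_vars_compose2)
  moreover have "cdf (distr M borel (\<lambda>\<omega>. f (X i \<omega>))) = G" if i: "i \<in> {1..n}" for i
  proof
    fix u
    have "(\<lambda>\<omega>. f (X i \<omega>)) -` {..u} \<inter> space M = {\<omega>\<in>space M. f (X i \<omega>) \<le> u}" by auto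
    then show "cdf (distr M borel (\<lambda>\<omega>. f (X i \<omega>))) u = G u"
      using measurable_compose[OF iid_with_cdf_measurable[OF X i] f] G[OF i, of u]
      by (simp add: cdf_def measure_distr)
  qed
  ultimately show ?thesis using prob_space_axioms by (simp add: iid_with_cdf_def)
qed

lemma iid_uniform_reflect:
  assumes X: "iid_with_cdf M n X (cdf (uniform_measure lborel {0<..<1}))"
  shows "iid_with_cdf M n (\<lambda>i \<omega>. 1 - X i \<omega>) (cdf (uniform_measure lborel {0<..<1}))"
proof (rule iid_with_cdf_compose[OF X])
  fix i and u :: real assume i: "i \<in> {1..n}"
  let ?U = "uniform_measure lborel {0<..<1::real}"
  have distr: "distr M borel (X i) = ?U"
    using iid_with_cdf_distr[OF X i] real_distribution_uniform by (intro cdf_unique) auto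
  have "\<P>(\<omega> in M. 1 - X i \<omega> \<le> u) = measure (distr M borel (X i)) {1-u..}"
    using iid_with_cdf_measurable[OF X i]
    by (subst measure_distr) (auto intro!: arg_cong[where f="measure M"])
  also have "\<dots> = measure lborel ({0<..<1} \<inter> {1-u..})"
    unfolding distr by (simp add: measure_uniform_measure)
  also have "{0<..<1} \<inter> {1-u..} = (if u \<le> 0 then {} else if 1 \<le> u then {0<..<1} else {1-u..<1})"
    by auto
  also have "measure lborel \<dots> = cdf ?U u" by (simp add: cdf_uniform)
  finally show "\<P>(\<omega> in M. 1 - X i \<omega> \<le> u) = cdf ?U u" .
qed simp

lemma emp_cdf_exceeds_prob:
  assumes X: "iid_with_cdf M n X F" and n: "n \<ge> 1" and c: "c \<ge> 0"
  shows "\<P>(\<omega> in M. emp_cdf n (\<lambda>i. X i \<omega>) t \<ge> F t + c) \<le> exp (- 2 * real n * c\<^sup>2)"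
proof -
  interpret prob_space M using X by (simp add: iid_with_cdf_def)
  define Y :: "nat \<Rightarrow> 'a \<Rightarrow> real" where "Y i \<omega> = indicator {..t} (X i \<omega>)" for i \<omega>
  have indep: "indep_vars (\<lambda>_. borel) Y {1..n}"
    unfolding Y_def using X by (auto simp: iid_with_cdf_def intro: indep_vars_compose2)
  have E: "expectation (Y i) = F t" if i: "i \<in> {1..n}" for i
  proof -
    have "expectation (Y i) = (\<integral>x. indicator {..t} x \<partial>distr M borel (X i))"
      unfolding Y_def using iid_with_cdf_measurable[OF X i] by (subst integral_distr) auto
    also have "\<dots> = F t"
      using iid_with_cdf_distr(2)[OF X i] by (simp add: cdf_def fun_eq_iff)
    finally show ?thesis .
  qed
  interpret Hoeffding_ineq M "{1..n}" Y "\<lambda>_. 0" "\<lambda>_. 1" "\<Sum>i\<in>{1..n}. expectation (Y i)"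
    using indep by unfold_locales (auto simp: Y_def indicator_def)
  have "{\<omega>\<in>space M. emp_cdf n (\<lambda>i. X i \<omega>) t \<ge> F t + c} =
      {\<omega>\<in>space M. (\<Sum>i\<in>{1..n}. Y i \<omega>) \<ge> (\<Sum>i\<in>{1..n}. expectation (Y i)) + n * c}"
    using n by (simp add: E emp_cdf_sum Y_def field_simps)
  also have "prob \<dots> \<le> exp (- 2 * (n * c)\<^sup>2 / (\<Sum>i\<in>{1..n}. (1 - 0)\<^sup>2))"
    using n c by (intro Hoeffding_ineq_ge) auto
  also have "- 2 * (n * c)\<^sup>2 / (\<Sum>i\<in>{1..n}. (1 - 0)\<^sup>2) = - 2 * real n * c\<^sup>2"
    using n by (simp add: power2_eq_square)
  finally show ?thesis .
qed

section \<open>Normal mean mixtures and coverage\<close>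

context
  fixes M :: "'a measure" and X :: "nat \<Rightarrow> 'a \<Rightarrow> real" and n :: nat
    and \<epsilon> :: real and H :: "real measure" and F :: "real \<Rightarrow> real"
  assumes sample: "mixture_sample M n X \<epsilon> H" and n: "n \<ge> 2"
  defines "F \<equiv> mixture_cdf \<epsilon> H"
begin

interpretation H: real_distribution H
  using sample by (simp add: mixture_sample_def)

interpretation prob_space M
  using sample by (simp add: mixture_sample_def iid_with_cdf_def)

lemma mixing_weight_range: "0 \<le> \<epsilon>" "\<epsilon> \<le> 1"
  using sample by (auto simp: mixture_sample_def)

lemma sample_iid: "iid_with_cdf M n X F"
  using sample by (simp add: mixture_sample_def F_def)

lemma sample_borel: "i \<in> {1..n} \<Longrightarrow> X i \<in> borel_measurable M"
  using iid_with_cdf_measurable[OF sample_iid] .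

interpretation D: real_distribution "distr M borel (X 1)"
  using iid_with_cdf_distr(1)[OF sample_iid, of 1] n by simp

lemma cdf_first_observation: "cdf (distr M borel (X (Suc 0))) = F"
  using iid_with_cdf_distr(2)[OF sample_iid, of 1] n by simp

lemma integrable_shift: "integrable H (\<lambda>\<mu>. Phi (t - \<mu>))"
  by (rule integrable_Phi_shift) (rule H.real_distribution_axioms)

lemma mixture_cdf_strict_mono:
  assumes "s < t"
  shows "F s < F t"
proof -
  have less: "(\<integral>\<mu>. Phi (s - \<mu>) \<partial>H) < (\<integral>\<mu>. Phi (t - \<mu>) \<partial>H)"
    using assms H.emeasure_space_1
    by (intro H.integral_less_AE_space integrable_shift AE_I2) (auto intro: Phi_strict_mono)
  show ?thesis
  proof (cases "\<epsilon> = 0")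
    case True
    then show ?thesis using Phi_strict_mono[OF assms] by (simp add: F_def mixture_cdf_def)
  next
    case False
    then show ?thesis
      unfolding F_def mixture_cdf_def using mixing_weight_range less assms
      by (intro add_le_less_mono mult_left_mono mult_strict_left_mono Phi_mono) auto
  qed
qed

lemma mixture_cdf_mono: "s \<le> t \<Longrightarrow> F s \<le> F t"
  using mixture_cdf_strict_mono[of s t] by (cases "s = t") auto

lemma mixture_cdf_less_iff: "F s < F t \<longleftrightarrow> s < t"
  using mixture_cdf_mono mixture_cdf_strict_mono by (meson not_le)

lemma mixture_cdf_le_iff: "F s \<le> F t \<longleftrightarrow> s \<le> t"
  using mixture_cdf_less_iff by (meson not_le)

lemma mixture_cdf_bounds: "0 < F t" "F t < 1"
proof -
  show "0 < F t"
    using mixture_cdf_strict_mono[of "t - 1" t] D.cdf_nonneg[of "t - 1"] by (simp add: cdf_first_observation)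
  show "F t < 1"
    using mixture_cdf_strict_mono[of t "t + 1"] D.cdf_bounded_prob[of "t + 1"] by (simp add: cdf_first_observation)
qed

lemma mixture_cdf_borel: "F \<in> borel_measurable borel"
  by (rule borel_measurable_mono) (auto simp: mono_def mixture_cdf_mono)

lemma isCont_mixture_cdf: "isCont F t"
proof -
  have "isCont (\<lambda>t. \<integral>\<mu>. Phi (t - \<mu>) \<partial>H) t"
    unfolding continuous_at_sequentially o_def
  proof safe
    fix x assume x: "x \<longlonglongrightarrow> t"
    show "(\<lambda>k. \<integral>\<mu>. Phi (x k - \<mu>) \<partial>H) \<longlonglongrightarrow> (\<integral>\<mu>. Phi (t - \<mu>) \<partial>H)"
    proof (rule integral_dominated_convergence[where w="\<lambda>_. 1"])
      show "AE \<mu> in H. (\<lambda>k. Phi (x k - \<mu>)) \<longlonglongrightarrow> Phi (t - \<mu>)"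
        by (intro AE_I2 isCont_tendsto_compose[OF isCont_Phi] tendsto_intros x)
    qed (auto simp: Phi_nonneg Phi_le_1)
  qed
  then show ?thesis
    unfolding F_def mixture_cdf_def by (intro continuous_intros isCont_Phi)
qed

text \<open>The intermediate value theorem; the limits at both infinities come from \<open>F\<close> being the c.d.f. of
  an observation.\<close>
lemma mixture_cdf_surj:
  assumes "0 < u" "u < 1"
  obtains t where "F t = u"
proof -
  have "eventually (\<lambda>s. F s < u) at_bot" "eventually (\<lambda>s. u < F s) at_top"
    using order_tendstoD(2)[OF D.cdf_lim_at_bot assms(1)]
      order_tendstoD(1)[OF D.cdf_lim_at_top_prob assms(2)] by (simp_all add: cdf_first_observation)
  then obtain s t where st: "F s < u" "u < F t"
    by (auto simp: eventually_at_bot_linorder eventually_at_top_linorder)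
  then have "s < t" using mixture_cdf_less_iff[of s t] by linarith
  then obtain r where "F r = u"
    using IVT'[of F s u t] st by (auto intro: continuous_at_imp_continuous_on isCont_mixture_cdf)
  then show thesis by (rule that)
qed

lemma iid_mixture_cdf_uniform:
  "iid_with_cdf M n (\<lambda>i \<omega>. F (X i \<omega>)) (cdf (uniform_measure lborel {0<..<1}))"
proof (rule iid_with_cdf_compose[OF sample_iid mixture_cdf_borel])
  fix i and u :: real assume i: "i \<in> {1..n}"
  consider "u \<le> 0" | "1 \<le> u" | "0 < u" "u < 1" by linarith
  then show "\<P>(\<omega> in M. F (X i \<omega>) \<le> u) = cdf (uniform_measure lborel {0<..<1}) u"
  proof cases
    case 1
    have "\<not> F y \<le> u" for y using mixture_cdf_bounds(1)[of y] 1 by simp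
    then show ?thesis using 1 by (simp add: cdf_uniform)
  next
    case 2
    have "F y \<le> u" for y using mixture_cdf_bounds(2)[of y] 2 by simp
    then show ?thesis using 2 by (simp add: cdf_uniform prob_space)
  next
    case 3
    obtain t where t: "F t = u" using mixture_cdf_surj[OF 3] .
    have "\<P>(\<omega> in M. F (X i \<omega>) \<le> u) = measure (distr M borel (X i)) {..t}"
      using sample_borel[OF i] unfolding t[symmetric] mixture_cdf_le_iff
      by (subst measure_distr) (auto intro!: arg_cong[where f="measure M"])
    also have "\<dots> = F t"
      using iid_with_cdf_distr(2)[OF sample_iid i] by (simp add: cdf_def fun_eq_iff)
    finally show ?thesis using 3 t by (simp add: cdf_uniform)
  qed
qed

lemma AE_sample_avoids_countable:
  assumes "countable A"
  shows "AE \<omega> in M. \<forall>i\<in>{1..n}. X i \<omega> \<notin> A"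
proof (intro AE_finite_allI)
  fix i assume i: "i \<in> {1..n}"
  interpret Di: real_distribution "distr M borel (X i)"
    using iid_with_cdf_distr(1)[OF sample_iid i] .
  have "measure (distr M borel (X i)) {t} = 0" for t
    using Di.isCont_cdf[of t] isCont_mixture_cdf iid_with_cdf_distr(2)[OF sample_iid i] by simp
  then have "AE x in distr M borel (X i). \<forall>a\<in>A. x \<noteq> a"
    using assms by (auto simp: AE_ball_countable Di.prob_eq_0[symmetric] 
      intro!: AE_I[where N="{_}"] simp: Di.emeasure_eq_measure)
  then have "AE x in distr M borel (X i). x \<notin> A" by (rule eventually_mono) auto
  then show "AE \<omega> in M. X i \<omega> \<notin> A"
    using sample_borel[OF i] by (rule AE_distrD[rotated])
qed simp

text \<open>Positive shifts move mass to the right, which lowers the c.d.f.\<close>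
lemma mixture_cdf_le_Phi:
  assumes "measure H {0<..} = 1"
  shows "F t \<le> Phi t"
proof -
  have "AE \<mu> in H. \<mu> \<in> {0<..}" using assms by (rule H.AE_prob_1)
  then have "(\<integral>\<mu>. Phi (t - \<mu>) \<partial>H) \<le> (\<integral>\<mu>. Phi t \<partial>H)"
    by (intro integral_mono_AE integrable_shift) (auto elim!: eventually_mono intro: Phi_mono)
  then have "\<epsilon> * (\<integral>\<mu>. Phi (t - \<mu>) \<partial>H) \<le> \<epsilon> * Phi t"
    using mixing_weight_range H.prob_space by (intro mult_left_mono) auto
  then show ?thesis by (simp add: F_def mixture_cdf_def algebra_simps)
qed

text \<open>Shifts of at most \<open>b\<close> cannot lower the c.d.f. on the positive half-line below \<open>Phi (- b)\<close>. This is
  what keeps the reflected values \<open>1 - F t\<close> inside the range of the supremum in \<open>W_plus\<close>.\<close>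
lemma mixture_cdf_ge_Phi_minus:
  assumes "measure H {0<..b} = 1" "0 \<le> t" "0 \<le> b"
  shows "Phi (- b) \<le> F t"
proof -
  have "AE \<mu> in H. \<mu> \<in> {0<..b}" using assms(1) by (rule H.AE_prob_1)
  then have "AE \<mu> in H. Phi (- b) \<le> Phi (t - \<mu>)"
    by (rule eventually_mono) (use assms(2) in \<open>auto intro: Phi_mono\<close>)
  then have "(\<integral>\<mu>. Phi (- b) \<partial>H) \<le> (\<integral>\<mu>. Phi (t - \<mu>) \<partial>H)"
    by (intro integral_mono_AE integrable_shift) auto
  then have "\<epsilon> * Phi (- b) \<le> \<epsilon> * (\<integral>\<mu>. Phi (t - \<mu>) \<partial>H)"
    using mixing_weight_range H.prob_space by (intro mult_left_mono) auto
  moreover have "(1 - \<epsilon>) * Phi (- b) \<le> (1 - \<epsilon>) * Phi t"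
    using mixing_weight_range assms by (intro mult_left_mono Phi_mono) auto
  ultimately show ?thesis by (simp add: F_def mixture_cdf_def algebra_simps)
qed

lemma emp_cdf_transform: "emp_cdf n (\<lambda>i. F (x i)) (F t) = emp_cdf n x t"
  by (intro emp_cdf_cong) (simp add: mixture_cdf_le_iff)

text \<open>Reflection turns \<open>\<le>\<close> into \<open>\<ge>\<close>, so the identity fails exactly when an observation equals \<open>t\<close>.\<close>
lemma emp_process_reflect:
  assumes "\<forall>i\<in>{1..n}. x i \<noteq> t"
  shows "emp_process n (\<lambda>i. 1 - F (x i)) (1 - F t) = - emp_process n (\<lambda>i. F (x i)) (F t)"
proof -
  have "emp_cdf n (\<lambda>i. 1 - F (x i)) (1 - F t) = (\<Sum>i\<in>{1..n}. 1 - indicator {..t} (x i)) / n"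
    using assms unfolding emp_cdf_sum
    by (intro arg_cong2[where f="(/)"] sum.cong) (auto simp: indicator_def mixture_cdf_le_iff)
  also have "\<dots> = 1 - emp_cdf n x t"
    using n by (simp add: emp_cdf_sum sum_subtractf field_simps)
  finally have eq: "emp_cdf n (\<lambda>i. 1 - F (x i)) (1 - F t) = 1 - emp_cdf n x t" .
  show ?thesis by (simp add: emp_process_def emp_cdf_transform eq algebra_simps)
qed

lemma eps_hat_le_of_weighted_dev:
  assumes "\<And>t. 0 \<le> t \<Longrightarrow> t \<le> sqrt (2 * ln n) \<Longrightarrow> t \<in> range (grid n) \<Longrightarrow>
    weighted_dev n (\<lambda>i. F (x i)) (F t) < a"
  shows "eps_hat n a x \<le> \<epsilon>"
  using assms mixture_cdf_bounds mixing_weight_range(1) unfolding weighted_dev_def emp_process_def emp_cdf_transform unfolding F_def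
  by (intro eps_hat_le[OF n H.real_distribution_axioms]) auto

lemma weighted_dev_less_of_W_plus:
  assumes "W_plus n u < ereal a" "1/2 \<le> v" "v \<le> Phi (sqrt (2 * ln n))"
  shows "weighted_dev n u v < a"
proof -
  have "ereal (weighted_dev n u v) \<le> W_plus n u"
    unfolding W_plus_altdef using assms by (intro SUP_upper) auto
  then have "ereal (weighted_dev n u v) < ereal a" using assms(1) by (rule le_less_trans)
  then show ?thesis by simp
qed

text \<open>\<open>W_plus\<close> only controls the process above level \<open>1/2\<close>, but \<open>F t\<close> may be smaller at grid points.
  There the reflected sample is used, for which the level is \<open>1 - F t\<close> and the weight
  is the same. The need for two suprema is the reason for the level \<open>\<alpha> / 2\<close>.\<close>
lemma eps_hat_le_of_W_plus:
  assumes H1: "measure H {0<..sqrt (2 * ln n)} = 1"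
    and W: "W_plus n (\<lambda>i. F (x i)) < ereal a" "W_plus n (\<lambda>i. 1 - F (x i)) < ereal a"
    and no_ties: "\<forall>i\<in>{1..n}. x i \<notin> range (grid n)"
  shows "eps_hat n a x \<le> \<epsilon>"
proof (rule eps_hat_le_of_weighted_dev)
  fix t assume t: "0 \<le> t" "t \<le> sqrt (2 * ln n)" "t \<in> range (grid n)"
  let ?s = "sqrt (2 * ln (real n))"
  have "measure H {0<..?s} \<le> measure H {0<..}" by (intro H.finite_measure_mono) auto
  then have H0: "measure H {0<..} = 1" using H1 H.prob_le_1[of "{0<..}"] by simp
  have upper: "F t \<le> Phi ?s" using mixture_cdf_le_Phi[OF H0, of t] Phi_mono[OF t(2)] by simp
  have lower: "1 - F t \<le> Phi ?s"
    using mixture_cdf_ge_Phi_minus[OF H1 t(1)] Phi_minus[of ?s] n by simp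
  show "weighted_dev n (\<lambda>i. F (x i)) (F t) < a"
  proof (cases "1/2 \<le> F t")
    case True
    then show ?thesis using weighted_dev_less_of_W_plus[OF W(1)] upper by simp
  next
    case False
    then have "weighted_dev n (\<lambda>i. 1 - F (x i)) (1 - F t) < a"
      using weighted_dev_less_of_W_plus[OF W(2)] lower by simp
    moreover have "\<forall>i\<in>{1..n}. x i \<noteq> t" using no_ties t(3) by auto
    ultimately show ?thesis
      by (simp add: weighted_dev_def emp_process_reflect mult.commute)
  qed
qed

text \<open>Since \<open>F 0\<close> is the smallest value of \<open>F\<close> at nonnegative points, the random range of \<open>W_plusplus\<close>
  contains the values of \<open>F\<close> on \<open>[0, sqrt (2 * ln n)]\<close> as soon as the empirical c.d.f. at \<open>0\<close> is
  not too far above \<open>F 0\<close>.\<close>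
lemma eps_hat_le_of_W_plusplus:
  assumes H0: "measure H {0<..} = 1"
    and W: "W_plusplus n F x < ereal a"
    and close: "emp_cdf n x 0 < F 0 + sqrt (3 * ln n) / sqrt n"
  shows "eps_hat n a x \<le> \<epsilon>"
proof (rule eps_hat_le_of_weighted_dev)
  fix t assume t: "0 \<le> t" "t \<le> sqrt (2 * ln n)"
  have "F t \<le> Phi (sqrt (2 * ln n))" using mixture_cdf_le_Phi[OF H0, of t] Phi_mono[OF t(2)] by simp
  moreover have "F 0 \<le> F t" using t by (intro mixture_cdf_mono)
  ultimately have "ereal (weighted_dev n (\<lambda>i. F (x i)) (F t)) \<le> W_plusplus n F x"
    unfolding W_plusplus_altdef using mixture_cdf_bounds[of t] close by (intro SUP_upper) auto
  then have "ereal (weighted_dev n (\<lambda>i. F (x i)) (F t)) < ereal a" using W by (rule le_less_trans)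
  then show "weighted_dev n (\<lambda>i. F (x i)) (F t) < a" by simp
qed

lemma coverage_compact:
  fixes N :: "'b measure"
  assumes H1: "measure H {0<..sqrt (2 * ln n)} = 1"
    and U: "iid_with_cdf N n U (cdf (uniform_measure lborel {0<..<1}))"
    and a: "\<P>(\<omega> in N. W_plus n (\<lambda>i. U i \<omega>) \<ge> ereal a) \<le> \<alpha> / 2"
  shows "\<P>(\<omega> in M. eps_hat n a (\<lambda>i. X i \<omega>) \<le> \<epsilon>) \<ge> 1 - \<alpha>"
proof -
  let ?E = "{\<omega>\<in>space M. eps_hat n a (\<lambda>i. X i \<omega>) \<le> \<epsilon>}"
  let ?A = "{\<omega>\<in>space M. W_plus n (\<lambda>i. F (X i \<omega>)) \<ge> ereal a}"
  let ?B = "{\<omega>\<in>space M. W_plus n (\<lambda>i. 1 - F (X i \<omega>)) \<ge> ereal a}"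
  note unif = iid_mixture_cdf_uniform iid_uniform_reflect[OF iid_mixture_cdf_uniform]
  have sets: "?E \<in> events" "?A \<in> events" "?B \<in> events"
    using measurable_eps_hat_le[OF sample_borel n] measurable_W_plus[OF iid_with_cdf_measurable[OF unif(1)]]
      measurable_W_plus[OF iid_with_cdf_measurable[OF unif(2)]] by auto
  have "prob ?A \<le> \<alpha> / 2" "prob ?B \<le> \<alpha> / 2"
    using prob_W_plus_cong[OF unif(1) U, of "ereal a"] prob_W_plus_cong[OF unif(2) U, of "ereal a"] a n
    by simp_all
  then have "1 - \<alpha> \<le> 1 - prob (?A \<union> ?B)"
    using measure_Un_le[OF sets(2,3)] by simp
  also have "\<dots> = prob (space M - (?A \<union> ?B))" using sets by (intro prob_compl[symmetric]) auto
  also have "\<dots> \<le> prob ?E"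
  proof (rule finite_measure_mono_AE)
    have "AE \<omega> in M. \<forall>i\<in>{1..n}. X i \<omega> \<notin> range (grid n)"
      by (intro AE_sample_avoids_countable countable_image countableI_type)
    then show "AE \<omega> in M. \<omega> \<in> space M - (?A \<union> ?B) \<longrightarrow> \<omega> \<in> ?E"
      by (rule eventually_mono) (auto simp: not_le intro!: eps_hat_le_of_W_plus[OF H1])
  qed (rule sets)
  finally show ?thesis .
qed

text \<open>The loss \<open>1 / n ^ 6\<close> is the Hoeffding bound \<open>exp (- 2 * n * c\<^sup>2)\<close> for \<open>c = sqrt (3 * ln n / n)\<close>; it depends
  neither on \<open>\<epsilon>\<close> nor on \<open>H\<close>, which gives uniformity.\<close>
lemma coverage_half_line:
  assumes H0: "measure H {0<..} = 1"
    and a: "\<P>(\<omega> in M. W_plusplus n F (\<lambda>i. X i \<omega>) \<ge> ereal a) \<le> \<alpha>"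
  shows "\<P>(\<omega> in M. eps_hat n a (\<lambda>i. X i \<omega>) \<le> \<epsilon>) \<ge> 1 - \<alpha> - 1 / n ^ 6"
proof -
  let ?E = "{\<omega>\<in>space M. eps_hat n a (\<lambda>i. X i \<omega>) \<le> \<epsilon>}"
  let ?A = "{\<omega>\<in>space M. W_plusplus n F (\<lambda>i. X i \<omega>) \<ge> ereal a}"
  let ?c = "sqrt (3 * ln n) / sqrt n"
  let ?B = "{\<omega>\<in>space M. emp_cdf n (\<lambda>i. X i \<omega>) 0 \<ge> F 0 + ?c}"
  have sets: "?E \<in> events" "?A \<in> events" "?B \<in> events"
    using measurable_eps_hat_le[OF sample_borel n] measurable_W_plusplus[OF sample_borel mixture_cdf_borel]
      measurable_emp_cdf[OF sample_borel] by auto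
  have "prob ?B \<le> exp (- 2 * n * ?c\<^sup>2)"
    using emp_cdf_exceeds_prob[OF sample_iid, of ?c 0] n by simp
  also have "- 2 * n * ?c\<^sup>2 = - (6 * ln n)" using n by (simp add: power_divide)
  also have "exp (- (6 * ln n)) = 1 / n ^ 6"
    using n exp_of_nat_mult[of 6 "ln n"] by (simp add: exp_minus inverse_eq_divide)
  finally have "1 - \<alpha> - 1 / n ^ 6 \<le> 1 - prob (?A \<union> ?B)"
    using measure_Un_le[OF sets(2,3)] a by simp
  also have "\<dots> = prob (space M - (?A \<union> ?B))" using sets by (intro prob_compl[symmetric]) auto
  also have "\<dots> \<le> prob ?E"
    by (rule finite_measure_mono) (auto simp: not_le sets intro!: eps_hat_le_of_W_plusplus[OF H0] sets)
  finally show ?thesis .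
qed

end

theorem theorem5p1:
  fixes \<alpha> :: real
  assumes "0 < \<alpha>" and "\<alpha> < 1"
  shows
    "(\<forall>n\<ge>2. \<forall>(N :: 'b measure) U a.
        iid_with_cdf N n U (cdf (uniform_measure lborel {0<..<1})) \<longrightarrow>
        \<P>(\<omega> in N. W_plus n (\<lambda>i. U i \<omega>) \<ge> ereal a) \<le> \<alpha> / 2 \<longrightarrow>
        (\<forall>(M :: 'a measure) X \<epsilon> H.
          mixture_sample M n X \<epsilon> H \<longrightarrow>
          measure H {0<..sqrt (2 * ln (real n))} = 1 \<longrightarrow>
          \<P>(\<omega> in M. eps_hat n a (\<lambda>i. X i \<omega>) \<le> \<epsilon>) \<ge> 1 - \<alpha>))
     \<and>
     (\<exists>\<delta> :: nat \<Rightarrow> real. \<delta> \<longlonglongrightarrow> 0 \<and>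
        (\<forall>n\<ge>2. \<forall>(M :: 'a measure) X \<epsilon> H a.
          mixture_sample M n X \<epsilon> H \<longrightarrow>
          measure H {0<..} = 1 \<longrightarrow>
          \<P>(\<omega> in M. W_plusplus n (mixture_cdf \<epsilon> H) (\<lambda>i. X i \<omega>) \<ge> ereal a) \<le> \<alpha> \<longrightarrow>
          \<P>(\<omega> in M. eps_hat n a (\<lambda>i. X i \<omega>) \<le> \<epsilon>) \<ge> (1 - \<alpha>) * (1 + \<delta> n)))"
proof (intro conjI allI impI)
  fix n :: nat and N :: "'b measure" and U a and M :: "'a measure" and X \<epsilon> H
  assume "2 \<le> n" "iid_with_cdf N n U (cdf (uniform_measure lborel {0<..<1}))"
    "\<P>(\<omega> in N. W_plus n (\<lambda>i. U i \<omega>) \<ge> ereal a) \<le> \<alpha> / 2"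
    "mixture_sample M n X \<epsilon> H" "measure H {0<..sqrt (2 * ln (real n))} = 1"
  then show "\<P>(\<omega> in M. eps_hat n a (\<lambda>i. X i \<omega>) \<le> \<epsilon>) \<ge> 1 - \<alpha>"
    by (intro coverage_compact)
next
  \<comment> \<open>Chosen so that \<open>(1 - \<alpha>) * \<delta> n\<close> is exactly the loss \<open>- 1 / n ^ 6\<close>.\<close>
  define \<delta> where "\<delta> n = - (1 / real n ^ 6) / (1 - \<alpha>)" for n
  have "(\<lambda>n. 1 / real n ^ 6) \<longlonglongrightarrow> 0"
    by (rule tendsto_eq_rhs[OF tendsto_power[OF lim_1_over_n, of 6, unfolded power_one_over]]) simp
  then have "\<delta> \<longlonglongrightarrow> - 0 / (1 - \<alpha>)"
    unfolding \<delta>_def using assms by (intro tendsto_intros) auto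
  moreover have "\<P>(\<omega> in M. eps_hat n a (\<lambda>i. X i \<omega>) \<le> \<epsilon>) \<ge> (1 - \<alpha>) * (1 + \<delta> n)"
    if "2 \<le> n" "mixture_sample M n X \<epsilon> H" "measure H {0<..} = 1"
      "\<P>(\<omega> in M. W_plusplus n (mixture_cdf \<epsilon> H) (\<lambda>i. X i \<omega>) \<ge> ereal a) \<le> \<alpha>"
    for n and M :: "'a measure" and X \<epsilon> H a
  proof -
    have "(1 - \<alpha>) * \<delta> n = - (1 / real n ^ 6)"
      using assms by (simp add: \<delta>_def)
    then have "(1 - \<alpha>) * (1 + \<delta> n) = 1 - \<alpha> - 1 / real n ^ 6"
      by (simp add: algebra_simps)
    then show ?thesis using coverage_half_line[OF that(2,1,3,4)] by simp
  qed
  ultimately show "\<exists>\<delta> :: nat \<Rightarrow> real. \<delta> \<longlonglongrightarrow> 0 \<and>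
        (\<forall>n\<ge>2. \<forall>(M :: 'a measure) X \<epsilon> H a.
          mixture_sample M n X \<epsilon> H \<longrightarrow>
          measure H {0<..} = 1 \<longrightarrow>
          \<P>(\<omega> in M. W_plusplus n (mixture_cdf \<epsilon> H) (\<lambda>i. X i \<omega>) \<ge> ereal a) \<le> \<alpha> \<longrightarrow>
          \<P>(\<omega> in M. eps_hat n a (\<lambda>i. X i \<omega>) \<le> \<epsilon>) \<ge> (1 - \<alpha>) * (1 + \<delta> n))"
    by (intro exI[of _ \<delta>]) simp
qed

end
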